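(* Let $\mathbf{O}$ be a decent class of operators. Then every locally uniformly $\mathbf{O}$-computable real function $\theta:D\to\mathbb{R}$ whose domain $D\subseteq\mathbb{R}^N$ is compact is uniformly $\mathbf{O}$-computable.
   Context: For $m\in\mathbb{N}$, $\mathbb{T}_m$ is the set of all total functions $\mathbb{N}^m\to\mathbb{N}$. For $k\in\mathbb{N}$, a $k$-ary operator is a mapping $\mathbb{T}_1^k\to\mathbb{T}_1$. For $c\in\mathbb{N}$, $\check{c}\in\mathbb{T}_1$ is the constant function with value $c$. A class $\mathbf{O}$ of operators is appropriate if: (1) for all $k$ and $i\in\{1,\ldots,k\}$ the operator $(f_1,\ldots,f_k)\mapsto f_i$ is in $\mathbf{O}$; (2) the operator $F(f_1,f_2)(n)=f_1(f_2(n))$ is in $\mathbf{O}$; (3) if $F$ is a $k$-ary operator in $\mathbf{O}$ and $G_1,\ldots,G_k$ are $l$-ary operators in $\mathbf{O}$, then $H(g_1,\ldots,g_l)=F(G_1(g_1,\ldots,g_l),\ldots,G_k(g_1,\ldots,g_l))$ is in $\mathbf{O}$; (4) if $F$ is a $(k+1)$-ary operator in $\mathbf{O}$, then $G(f_1,\ldots,f_k)(n)=F(f_1,\ldots,f_k,\check{n})(n)$ is in $\mathbf{O}$. For $f:\mathbb{N}^k\to\mathbb{N}$, $\mathring{f}(f_1,\ldots,f_k)(n)=f(f_1(n),\ldots,f_k(n))$; $f$ is $\mathbf{O}$-representable if $\mathring{f}\in\mathbf{O}$. The class $\mathbf{O}$ is decent if it is appropriate and the functions $\lambda x.x+1$,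 $\lambda xy.x\dotminus y$ (truncated subtraction) and $\delta_1$ are $\mathbf{O}$-representable, where $\delta_1(x,y,z)=y$ if $x=0$ and $z$ otherwise. A triple $(f,g,h)\in\mathbb{T}_1^3$ names $\xi\in\mathbb{R}$ if $\left|\frac{f(t)-g(t)}{h(t)+1}-\xi\right|<\frac{1}{t+1}$ for all $t$. A function $\theta:D\to\mathbb{R}$, $D\subseteq\mathbb{R}^N$, is uniformly $\mathbf{O}$-computable if there are $3N$-ary $F,G,H\in\mathbf{O}$ such that whenever $(\xi_1,\ldots,\xi_N)\in D$ and $(f_j,g_j,h_j)$ names $\xi_j$ ($j=1,\ldots,N$), the triple $(F(\bar f),G(\bar f),H(\bar f))$, with $\bar f=(f_1,g_1,h_1,\ldots,f_N,g_N,h_N)$, names $\theta(\xi_1,\ldots,\xi_N)$; it is locally uniformly $\mathbf{O}$-computable if every point of $D$ has a neighbourhood $U$ such that the restriction of $\theta$ to $D\cap U$ is uniformly $\mathbf{O}$-computable. *)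

theory Defs
  imports "HOL-Analysis.Analysis"
begin

text \<open>
  A tuple \<open>(f\<^sub>1, \<dots>, f\<^sub>k)\<close> of unary total functions is a list of length \<open>k\<close>, so \<open>f\<^sub>i\<close> is
  \<open>fs ! (i - 1)\<close>.  A \<open>k\<close>-ary operator is an extensional function on such tuples; this makes
  equality of operators coincide with equality of mappings on \<open>k\<close>-tuples.  Since a HOL function
  does not carry its domain, a class of operators is given by its \<open>k\<close>-ary members for each arity
  \<open>k \<ge> 0\<close>.
\<close>

type_synonym operator = "(nat \<Rightarrow> nat) list \<Rightarrow> (nat \<Rightarrow> nat)"

definition tuples :: "nat \<Rightarrow> (nat \<Rightarrow> nat) list set" where
  "tuples k = {fs. length fs = k}"

definition operators :: "nat \<Rightarrow> operator set" where
  "operators k = (tuples k \<rightarrow>\<^sub>E UNIV)"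

definition operator_class :: "(nat \<Rightarrow> operator set) \<Rightarrow> bool" where
  "operator_class \<O> \<longleftrightarrow> (\<forall>k. \<O> k \<subseteq> operators k)"

definition appropriate :: "(nat \<Rightarrow> operator set) \<Rightarrow> bool" where
  "appropriate \<O> \<longleftrightarrow>
     operator_class \<O> \<and>
     (\<forall>k. \<forall>i<k. (\<lambda>fs\<in>tuples k. fs ! i) \<in> \<O> k) \<and>
     (\<lambda>fs\<in>tuples 2. \<lambda>n. (fs ! 0) ((fs ! 1) n)) \<in> \<O> 2 \<and>
     (\<forall>k l. \<forall>F\<in>\<O> k. \<forall>Gs. length Gs = k \<and> set Gs \<subseteq> \<O> l \<longrightarrow>
        (\<lambda>gs\<in>tuples l. F (map (\<lambda>G. G gs) Gs)) \<in> \<O> l) \<and>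
     (\<forall>k. \<forall>F\<in>\<O> (k + 1). (\<lambda>fs\<in>tuples k. \<lambda>n. F (fs @ [\<lambda>_. n]) n) \<in> \<O> k)"

text \<open>
  A function \<open>\<nat>\<^sup>k \<rightarrow> \<nat>\<close> is a function on lists of naturals of which only the values on lists of
  length \<open>k\<close> matter.
\<close>

definition pointwise :: "nat \<Rightarrow> (nat list \<Rightarrow> nat) \<Rightarrow> operator" where
  "pointwise k f = (\<lambda>fs\<in>tuples k. \<lambda>n. f (map (\<lambda>g. g n) fs))"

definition representable :: "(nat \<Rightarrow> operator set) \<Rightarrow> nat \<Rightarrow> (nat list \<Rightarrow> nat) \<Rightarrow> bool" where
  "representable \<O> k f \<longleftrightarrow> pointwise k f \<in> \<O> k"

definition decent :: "(nat \<Rightarrow> operator set) \<Rightarrow> bool" where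
  "decent \<O> \<longleftrightarrow>
     appropriate \<O> \<and>
     representable \<O> 1 (\<lambda>xs. xs ! 0 + 1) \<and>
     representable \<O> 2 (\<lambda>xs. xs ! 0 - xs ! 1) \<and>
     representable \<O> 3 (\<lambda>xs. if xs ! 0 = 0 then xs ! 1 else xs ! 2)"

definition names :: "(nat \<Rightarrow> nat) \<Rightarrow> (nat \<Rightarrow> nat) \<Rightarrow> (nat \<Rightarrow> nat) \<Rightarrow> real \<Rightarrow> bool" where
  "names f g h \<xi> \<longleftrightarrow>
     (\<forall>t. \<bar>(real (f t) - real (g t)) / (real (h t) + 1) - \<xi>\<bar> < 1 / (real t + 1))"

text \<open>
  The space \<open>\<real>\<^sup>N\<close> is \<^term>\<open>Euclidean_space N\<close>, whose points are the sequences
  \<open>\<xi> :: nat \<Rightarrow> real\<close> with \<open>\<xi> j = 0\<close> for \<open>j \<ge> N\<close>; coordinates are numbered from \<open>0\<close>.  A real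
  function with domain \<open>D\<close> is a pair of \<open>D\<close> and a function whose values outside \<open>D\<close> are ignored,
  so its restriction to \<open>D \<inter> U\<close> is obtained by replacing \<open>D\<close> with \<open>D \<inter> U\<close>.
\<close>

definition uniformly_computable ::
    "(nat \<Rightarrow> operator set) \<Rightarrow> nat \<Rightarrow> (nat \<Rightarrow> real) set \<Rightarrow> ((nat \<Rightarrow> real) \<Rightarrow> real) \<Rightarrow> bool" where
  "uniformly_computable \<O> N D \<theta> \<longleftrightarrow>
     (\<exists>F\<in>\<O> (3 * N). \<exists>G\<in>\<O> (3 * N). \<exists>H\<in>\<O> (3 * N).
        \<forall>\<xi>\<in>D. \<forall>f g h. (\<forall>j<N. names (f j) (g j) (h j) (\<xi> j)) \<longrightarrow>
          (let fs = concat (map (\<lambda>j. [f j, g j, h j]) [0..<N])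
           in names (F fs) (G fs) (H fs) (\<theta> \<xi>)))"

definition locally_uniformly_computable ::
    "(nat \<Rightarrow> operator set) \<Rightarrow> nat \<Rightarrow> (nat \<Rightarrow> real) set \<Rightarrow> ((nat \<Rightarrow> real) \<Rightarrow> real) \<Rightarrow> bool" where
  "locally_uniformly_computable \<O> N D \<theta> \<longleftrightarrow>
     (\<forall>\<xi>\<in>D. \<exists>U V. openin (Euclidean_space N) V \<and> \<xi> \<in> V \<and> V \<subseteq> U \<and>
        uniformly_computable \<O> N (D \<inter> U) \<theta>)"

end

theory Submission imports Defs begin

text \<open>
  Cover the compact domain by finitely many small boxes, each one well inside a neighbourhood on
  which \<open>\<theta>\<close> is uniformly computable, and select the right local algorithm by looking at one
  sufficiently precise rational approximation of every coordinate.  The only obstacle is to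
  compare such an approximation \<open>(f - g) / (h + 1)\<close> with a fixed rational number, because neither
  addition nor multiplication need be representable in a decent class; the subtractive Euclidean
  algorithm, run on the fixed numerator and denominator, decides \<open>q * a \<le> p * b\<close> by truncated
  subtraction and case distinction alone.
\<close>

section \<open>Closure properties of decent classes\<close>

text \<open>Members of a class are extensional, so a lambda term qualifies only after restriction to
  tuples of the right length. \<open>in_class\<close> hides this restriction, which lets the closure
  rules be chained on plain terms.\<close>

definition in_class ::
    "(nat \<Rightarrow> operator set) \<Rightarrow> nat \<Rightarrow> ((nat \<Rightarrow> nat) list \<Rightarrow> nat \<Rightarrow> nat) \<Rightarrow> bool" where
  "in_class \<O> k A \<longleftrightarrow> restrict A (tuples k) \<in> \<O> k"

text \<open>Truth is coded by 0 because the case distinction available in a decent class branches on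
  its first argument being 0.\<close>

definition decidable_in ::
    "(nat \<Rightarrow> operator set) \<Rightarrow> nat \<Rightarrow> ((nat \<Rightarrow> nat) list \<Rightarrow> nat \<Rightarrow> bool) \<Rightarrow> bool" where
  "decidable_in \<O> k P \<longleftrightarrow> in_class \<O> k (\<lambda>fs n. if P fs n then 0 else 1)"

context
  fixes \<O> :: "nat \<Rightarrow> operator set"
  assumes dec: "decent \<O>"
begin

lemma in_classI: "F \<in> \<O> k \<Longrightarrow> in_class \<O> k F"
proof -
  assume F: "F \<in> \<O> k"
  then have "F \<in> operators k"
    using dec unfolding decent_def appropriate_def operator_class_def by blast
  then have "restrict F (tuples k) = F"
    unfolding operators_def by (metis PiE_restrict)
  with F show ?thesis
    unfolding in_class_def by simp
qed

lemma in_class_cong: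
  assumes "in_class \<O> k A" "\<And>fs n. length fs = k \<Longrightarrow> A fs n = B fs n"
  shows "in_class \<O> k B"
proof -
  have "restrict A (tuples k) = restrict B (tuples k)"
    using assms(2) by (intro restrict_ext ext) (simp add: tuples_def)
  with assms(1) show ?thesis
    by (simp add: in_class_def)
qed

text \<open>This is closure under substitution, with the outer arity read off from the length of
  \<open>As\<close>. An empty list is allowed and turns a nullary operator into one of any arity
  \<open>l\<close>.\<close>

lemma in_class_subst:
  assumes "F \<in> \<O> (length As)" "\<And>A. A \<in> set As \<Longrightarrow> in_class \<O> l A"
  shows "in_class \<O> l (\<lambda>gs. F (map (\<lambda>A. A gs) As))"
proof -
  define Gs where "Gs = map (\<lambda>A. restrict A (tuples l)) As"
  have "set Gs \<subseteq> \<O> l" "length Gs = length As"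
    using assms(2) by (auto simp: Gs_def in_class_def)
  with assms(1) have "in_class \<O> l (\<lambda>gs. F (map (\<lambda>G. G gs) Gs))"
    using dec unfolding decent_def appropriate_def in_class_def by blast
  then show ?thesis
    by (rule in_class_cong) (simp add: Gs_def comp_def tuples_def)
qed

lemma in_class_proj: "i < k \<Longrightarrow> in_class \<O> k (\<lambda>fs. fs ! i)"
  using dec unfolding decent_def appropriate_def in_class_def by blast

lemma in_class_comp:
  assumes "in_class \<O> k A" "in_class \<O> k B"
  shows "in_class \<O> k (\<lambda>fs n. A fs (B fs n))"
proof -
  have "(\<lambda>fs\<in>tuples 2. \<lambda>n. (fs ! 0) ((fs ! 1) n)) \<in> \<O> (length [A, B])"
    using dec unfolding decent_def appropriate_def by (simp add: numeral_2_eq_2)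
  from in_class_subst[OF this, of k] show ?thesis
    using assms by (auto intro: in_class_cong simp: tuples_def)
qed

lemma in_class_Suc:
  assumes "in_class \<O> k A"
  shows "in_class \<O> k (\<lambda>fs n. Suc (A fs n))"
proof -
  have "pointwise 1 (\<lambda>xs. xs ! 0 + 1) \<in> \<O> (length [A])"
    using dec unfolding decent_def representable_def by simp
  from in_class_subst[OF this, of k] show ?thesis
    using assms by (auto intro: in_class_cong simp: tuples_def pointwise_def)
qed

lemma in_class_diff:
  assumes "in_class \<O> k A" "in_class \<O> k B"
  shows "in_class \<O> k (\<lambda>fs n. A fs n - B fs n)"
proof -
  have "pointwise 2 (\<lambda>xs. xs ! 0 - xs ! 1) \<in> \<O> (length [A, B])"
    using dec unfolding decent_def representable_def by (simp add: numeral_2_eq_2)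
  from in_class_subst[OF this, of k] show ?thesis
    using assms by (auto intro: in_class_cong simp: tuples_def pointwise_def)
qed

lemma in_class_if_zero:
  assumes "in_class \<O> k A" "in_class \<O> k B" "in_class \<O> k C"
  shows "in_class \<O> k (\<lambda>fs n. if A fs n = 0 then B fs n else C fs n)"
proof -
  have "pointwise 3 (\<lambda>xs. if xs ! 0 = 0 then xs ! 1 else xs ! 2) \<in> \<O> (length [A, B, C])"
    using dec unfolding decent_def representable_def by (simp add: numeral_3_eq_3)
  from in_class_subst[OF this, of k] show ?thesis
    using assms
    by (auto intro: in_class_cong simp: tuples_def pointwise_def nth_Cons' cong: if_cong)
qed

text \<open>
  Arity \<open>0\<close> needs condition (4): it turns the unary projection into a nullary operator with value
  \<open>\<lambda>n. n\<close>.
\<close>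

lemma in_class_const: "in_class \<O> k (\<lambda>fs n. c)"
proof (induction c)
  case 0
  have diag: "\<forall>k. \<forall>F\<in>\<O> (k + 1). (\<lambda>fs\<in>tuples k. \<lambda>n. F (fs @ [\<lambda>_. n]) n) \<in> \<O> k"
    using dec unfolding decent_def appropriate_def by blast
  have "(\<lambda>fs\<in>tuples 1. fs ! 0) \<in> \<O> (0 + 1)"
    using in_class_proj[of 0 1] unfolding in_class_def by simp
  from diag[rule_format, OF this]
  have *: "(\<lambda>fs\<in>tuples 0. \<lambda>n. (\<lambda>fs\<in>tuples 1. fs ! 0) (fs @ [\<lambda>_. n]) n) \<in> \<O> (length [])"
    by simp
  \<comment> \<open>Substituting the empty list into the nullary identity gives the identity at
    every arity. Truncated subtraction of it from itself then yields the constant 0.\<close>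
  have "in_class \<O> k (\<lambda>fs n. n)"
    by (rule in_class_cong[OF in_class_subst[OF *]]) (auto simp: tuples_def)
  from in_class_diff[OF this this] show ?case
    by simp
next
  case (Suc c)
  then show ?case
    by (rule in_class_Suc)
qed

section \<open>Decidable predicates and case distinctions\<close>

lemma in_class_if:
  assumes "decidable_in \<O> k P" "in_class \<O> k A" "in_class \<O> k B"
  shows "in_class \<O> k (\<lambda>fs n. if P fs n then A fs n else B fs n)"
  by (rule in_class_cong[OF in_class_if_zero[OF assms(1)[unfolded decidable_in_def] assms(2,3)]])
    auto

lemma decidable_in_const: "decidable_in \<O> k (\<lambda>fs n. b)"
  unfolding decidable_in_def by (rule in_class_const)

lemma decidable_in_if:
  assumes "decidable_in \<O> k P" "decidable_in \<O> k Q" "decidable_in \<O> k R"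
  shows "decidable_in \<O> k (\<lambda>fs n. if P fs n then Q fs n else R fs n)"
  unfolding decidable_in_def
  by (rule in_class_cong[OF in_class_if[OF assms(1) assms(2,3)[unfolded decidable_in_def]]]) auto

lemma decidable_in_not:
  "decidable_in \<O> k P \<Longrightarrow> decidable_in \<O> k (\<lambda>fs n. \<not> P fs n)"
  using decidable_in_if[OF _ decidable_in_const[of k False] decidable_in_const[of k True]]
  by (simp add: if_bool_eq_conj)

lemma decidable_in_conj:
  assumes "decidable_in \<O> k P" "decidable_in \<O> k Q"
  shows "decidable_in \<O> k (\<lambda>fs n. P fs n \<and> Q fs n)"
  using decidable_in_if[OF assms decidable_in_const[of k False]]
  unfolding decidable_in_def by (rule in_class_cong) auto

lemma decidable_in_ball:
  fixes P :: "nat \<Rightarrow> (nat \<Rightarrow> nat) list \<Rightarrow> nat \<Rightarrow> bool"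
  assumes "\<And>j. j < m \<Longrightarrow> decidable_in \<O> k (P j)"
  shows "decidable_in \<O> k (\<lambda>fs n. \<forall>j<m. P j fs n)"
  using assms
proof (induction m)
  case 0
  then show ?case
    by (simp add: decidable_in_const)
next
  case (Suc m)
  then have "decidable_in \<O> k (\<lambda>fs n. P m fs n \<and> (\<forall>j<m. P j fs n))"
    by (intro decidable_in_conj) auto
  then show ?case
    by (simp add: All_less_Suc)
qed

lemma decidable_in_le:
  assumes "in_class \<O> k A" "in_class \<O> k B"
  shows "decidable_in \<O> k (\<lambda>fs n. A fs n \<le> B fs n)"
proof -
  have "in_class \<O> k (\<lambda>fs n. if A fs n - B fs n = 0 then 0 else 1)"
    by (intro in_class_if_zero in_class_diff in_class_const assms)
  then show ?thesis
    unfolding decidable_in_def by simp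
qed

section \<open>Comparison of fractions with fixed rational numbers\<close>

text \<open>The products are never computed: \<open>p\<close> and \<open>q\<close> are fixed, and
  each round subtracts the smaller coefficient from the larger one while replacing \<open>A\<close>
  or \<open>B\<close> by a difference. Hence the induction on \<open>p + q\<close> must leave
  \<open>A\<close> and \<open>B\<close> arbitrary, and the recursion unfolds into finitely many
  nested case distinctions.\<close>

lemma decidable_in_scaled_le:
  assumes "in_class \<O> k A" "in_class \<O> k B"
  shows "decidable_in \<O> k (\<lambda>fs n. q * A fs n \<le> p * B fs n)"
  using assms
proof (induction "p + q" arbitrary: p q A B rule: less_induct)
  case less
  have le: "decidable_in \<O> k (\<lambda>fs n. A fs n \<le> B fs n)"
    using less.prems by (rule decidable_in_le)
  consider "q = 0" | "p = 0" "q > 0" | "0 < q" "q \<le> p" | "0 < p" "p < q"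
    by linarith
  then show ?case
  proof cases
    case 1
    then show ?thesis
      by (simp add: decidable_in_const)
  next
    case 2
    have "decidable_in \<O> k (\<lambda>fs n. A fs n \<le> 0)"
      using less.prems(1) in_class_const by (rule decidable_in_le)
    with 2 show ?thesis
      by simp
  next
    case 3
    have "decidable_in \<O> k (\<lambda>fs n. q * (A fs n - B fs n) \<le> (p - q) * B fs n)"
      using 3 less.prems by (intro less.hyps in_class_diff) auto
    from decidable_in_if[OF le decidable_in_const[of k True] this]
    have "decidable_in \<O> k (\<lambda>fs n. if A fs n \<le> B fs n then True
        else q * (A fs n - B fs n) \<le> (p - q) * B fs n)" .
    moreover have "(if a \<le> b then True else q * (a - b) \<le> (p - q) * b) \<longleftrightarrow> q * a \<le> p * b" for a b
    proof (cases "a \<le> b")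
      case True
      then show ?thesis
        using 3 by (simp add: mult_le_mono)
    next
      case False
      \<comment> \<open>Additive witnesses remove the truncated subtractions; the two inequalities
        then differ only by the summand \<open>q * b\<close> on both sides.\<close>
      then obtain d where "a = b + d"
        using le_Suc_ex nat_le_linear by blast
      moreover obtain e where "p = q + e"
        using 3 le_Suc_ex by blast
      ultimately show ?thesis
        using False by (simp add: algebra_simps)
    qed
    ultimately show ?thesis
      by simp
  next
    case 4
    have "decidable_in \<O> k (\<lambda>fs n. (q - p) * A fs n \<le> p * (B fs n - A fs n))"
      using 4 less.prems by (intro less.hyps in_class_diff) auto
    from decidable_in_if[OF le this decidable_in_const[of k False]]
    have "decidable_in \<O> k (\<lambda>fs n. if A fs n \<le> B fs n
        then (q - p) * A fs n \<le> p * (B fs n - A fs n) else False)" .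
    moreover have "(if a \<le> b then (q - p) * a \<le> p * (b - a) else False) \<longleftrightarrow> q * a \<le> p * b" for a b
    proof (cases "a \<le> b")
      case True
      \<comment> \<open>As before, with \<open>p * a\<close> as the common summand.\<close>
      then obtain d where "b = a + d"
        using le_Suc_ex by blast
      moreover obtain e where "q = p + e"
        using 4 less_imp_le le_Suc_ex by blast
      ultimately show ?thesis
        by (simp add: algebra_simps)
    next
      case False
      then have "p * b < q * a"
        using 4 by (intro mult_strict_mono) auto
      with False show ?thesis
        by simp
    qed
    ultimately show ?thesis
      by simp
  qed
qed

text \<open>Clearing denominators reduces the test to a scaled comparison of naturals, with
  \<open>Suc\<close> providing the denominator of the fraction. The sign of the numerator of
  \<open>r\<close> determines which of the two truncated differences represents the signed
  one.\<close>

lemma decidable_in_fraction_le_Rats: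
  assumes "in_class \<O> k A" "in_class \<O> k B" "in_class \<O> k C" "r \<in> \<rat>"
  shows "decidable_in \<O> k
    (\<lambda>fs n. (real (A fs n) - real (B fs n)) / (real (C fs n) + 1) \<le> r)"
proof -
  from assms(4) obtain p :: int and q :: nat where q: "q > 0" and r: "r = of_int p / of_nat q"
    by (elim Rats_cases') (metis of_int_of_nat_eq zero_less_imp_eq_int)
  have scale: "(real a - real b) / (real c + 1) \<le> r \<longleftrightarrow>
      real q * (real a - real b) \<le> of_int p * (real c + 1)" for a b c
    using q unfolding r by (simp add: divide_le_eq pos_le_divide_eq mult.commute)
  show ?thesis
  proof (cases "p \<ge> 0")
    case True
    \<comment> \<open>Truncation is harmless here: if \<open>a \<le> b\<close>, the fraction is at
      most 0, hence at most \<open>r\<close>, and the truncated difference makes the right side true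
      as well.\<close>
    have "(real a - real b) / (real c + 1) \<le> r \<longleftrightarrow> q * (a - b) \<le> nat p * Suc c" for a b c
    proof (cases "a \<le> b")
      case True
      then have "real q * (real a - real b) \<le> 0"
        by (simp add: mult_nonneg_nonpos)
      also have "\<dots> \<le> of_int p * (real c + 1)"
        using \<open>p \<ge> 0\<close> by simp
      finally show ?thesis
        using True unfolding scale by simp
    next
      case False
      then have "real (q * (a - b)) = real q * (real a - real b)"
        by (simp add: of_nat_diff)
      moreover have "real (nat p * Suc c) = of_int p * (real c + 1)"
        using \<open>p \<ge> 0\<close> by (simp add: algebra_simps)
      ultimately show ?thesis
        unfolding scale by (metis of_nat_le_iff)
    qed
    then show ?thesis
      by (simp only:) (intro decidable_in_scaled_le in_class_diff in_class_Suc assms)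
  next
    case False
    \<comment> \<open>Negating both sides brings in \<open>b - a\<close>. If
      \<open>b \<le> a\<close>, the fraction is nonnegative and \<open>r\<close> negative, while
      \<open>b - a\<close> truncates to 0 below a positive left side; both comparisons fail.\<close>
    have "(real a - real b) / (real c + 1) \<le> r \<longleftrightarrow> nat (- p) * Suc c \<le> q * (b - a)" for a b c
    proof -
      have neg: "real (nat (- p) * Suc c) = - (of_int p * (real c + 1))"
        using False by (simp add: algebra_simps)
      show ?thesis
      proof (cases "b \<le> a")
        case True
        then have "0 \<le> real q * (real a - real b)"
          by simp
        moreover have "of_int p * (real c + 1) < 0"
          using False by (simp add: mult_neg_pos)
        ultimately have "\<not> real q * (real a - real b) \<le> of_int p * (real c + 1)"
          by linarith
        then show ?thesis
          using True False unfolding scale by simp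
      next
        case False
        then have "real (q * (b - a)) = - (real q * (real a - real b))"
          by (simp add: of_nat_diff algebra_simps)
        with neg show ?thesis
          unfolding scale by (metis neg_le_iff_le of_nat_le_iff)
      qed
    qed
    then show ?thesis
      by (simp only:) (intro decidable_in_scaled_le in_class_diff in_class_Suc assms)
  qed
qed

section \<open>Gluing local algorithms\<close>

lemma nth_concat_triples:
  assumes "j < N"
  shows "concat (map (\<lambda>j. [f j, g j, h j]) [0..<N]) ! (3 * j) = f j"
    and "concat (map (\<lambda>j. [f j, g j, h j]) [0..<N]) ! (3 * j + 1) = g j"
    and "concat (map (\<lambda>j. [f j, g j, h j]) [0..<N]) ! (3 * j + 2) = h j"
proof -
  have len: "length (concat (map (\<lambda>j. [f j, g j, h j]) [0..<N])) = 3 * N" for N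
    by (induction N) auto
  from assms have "concat (map (\<lambda>j. [f j, g j, h j]) [0..<N]) ! (3 * j) = f j \<and>
      concat (map (\<lambda>j. [f j, g j, h j]) [0..<N]) ! (3 * j + 1) = g j \<and>
      concat (map (\<lambda>j. [f j, g j, h j]) [0..<N]) ! (3 * j + 2) = h j"
  proof (induction N)
    case (Suc N)
    then consider "j < N" | "j = N"
      by linarith
    then show ?case
    proof cases
      case 1
      with Suc.IH show ?thesis
        by (simp add: nth_append len)
    next
      case 2
      then show ?thesis
        by (simp add: nth_append len)
    qed
  qed simp
  then show "concat (map (\<lambda>j. [f j, g j, h j]) [0..<N]) ! (3 * j) = f j"
    and "concat (map (\<lambda>j. [f j, g j, h j]) [0..<N]) ! (3 * j + 1) = g j"
    and "concat (map (\<lambda>j. [f j, g j, h j]) [0..<N]) ! (3 * j + 2) = h j"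
    by auto
qed

text \<open>The predicate sees the names but not the argument \<open>n\<close>, so all three
  components follow the same branch throughout. It may answer differently for two names of one
  point: \<open>A\<close> and \<open>B\<close> may overlap, and either algorithm then names the same
  value.\<close>

lemma uniformly_computable_case_distinction:
  assumes P: "decidable_in \<O> (3 * N) (\<lambda>fs n. P fs)"
    and A: "uniformly_computable \<O> N A \<theta>"
    and B: "uniformly_computable \<O> N B \<theta>"
    and PD: "\<And>\<xi> f g h. \<xi> \<in> D \<Longrightarrow> (\<forall>j<N. names (f j) (g j) (h j) (\<xi> j)) \<Longrightarrow>
      (if P (concat (map (\<lambda>j. [f j, g j, h j]) [0..<N])) then \<xi> \<in> A else \<xi> \<in> B)"
  shows "uniformly_computable \<O> N D \<theta>"
proof -
  let ?fs = "\<lambda>f g h. concat (map (\<lambda>j. [f j, g j, h j :: nat \<Rightarrow> nat]) [0..<N])"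
  let ?if = "\<lambda>F F'. \<lambda>fs\<in>tuples (3 * N). \<lambda>n. if P fs then F fs n else F' fs n"
  obtain F G H where FGH: "F \<in> \<O> (3 * N)" "G \<in> \<O> (3 * N)" "H \<in> \<O> (3 * N)"
    and namesA: "\<And>\<xi> f g h. \<xi> \<in> A \<Longrightarrow> \<forall>j<N. names (f j) (g j) (h j) (\<xi> j) \<Longrightarrow>
      names (F (?fs f g h)) (G (?fs f g h)) (H (?fs f g h)) (\<theta> \<xi>)"
    using A unfolding uniformly_computable_def Let_def by blast
  obtain F' G' H' where FGH': "F' \<in> \<O> (3 * N)" "G' \<in> \<O> (3 * N)" "H' \<in> \<O> (3 * N)"
    and namesB: "\<And>\<xi> f g h. \<xi> \<in> B \<Longrightarrow> \<forall>j<N. names (f j) (g j) (h j) (\<xi> j) \<Longrightarrow>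
      names (F' (?fs f g h)) (G' (?fs f g h)) (H' (?fs f g h)) (\<theta> \<xi>)"
    using B unfolding uniformly_computable_def Let_def by blast
  have if_in: "?if F F' \<in> \<O> (3 * N)" if "F \<in> \<O> (3 * N)" "F' \<in> \<O> (3 * N)" for F F'
    using in_class_if[OF P in_classI[OF that(1)] in_classI[OF that(2)]]
    by (simp add: in_class_def)
  have tup: "?fs f g h \<in> tuples (3 * N)" for f g h
    unfolding tuples_def by (induction N) auto
  have "names (?if F F' (?fs f g h)) (?if G G' (?fs f g h)) (?if H H' (?fs f g h)) (\<theta> \<xi>)"
    if "\<xi> \<in> D" "\<forall>j<N. names (f j) (g j) (h j) (\<xi> j)" for \<xi> f g h
    using PD[OF that] namesA[OF _ that(2)] namesB[OF _ that(2)]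
    by (cases "P (?fs f g h)") (simp_all add: tup)
  then show ?thesis
    unfolding uniformly_computable_def Let_def
    using if_in[OF FGH(1) FGH'(1)] if_in[OF FGH(2) FGH'(2)] if_in[OF FGH(3) FGH'(3)] by blast
qed

text \<open>The naming condition is vacuous, but three operators of arity \<open>3 * N\<close> still
  have to be exhibited; constants serve.\<close>

lemma uniformly_computable_empty: "uniformly_computable \<O> N {} \<theta>"
  using in_class_const[of "3 * N" 0] unfolding uniformly_computable_def in_class_def by blast

lemma uniformly_computable_subset:
  "uniformly_computable \<O> N A \<theta> \<Longrightarrow> B \<subseteq> A \<Longrightarrow> uniformly_computable \<O> N B \<theta>"
  unfolding uniformly_computable_def by (meson subsetD)

text \<open>A finite approximation cannot decide strict inequalities between reals, so the test is
  sound only for a larger box than the one for which it is complete. An approximation with error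
  below \<delta> moves the small box to within 2\<delta> of the center; the cut-offs lie between
  2\<delta> and 3\<delta>, and moving back to the point adds another \<delta>.\<close>

lemma decidable_box_test:
  fixes c :: "nat \<Rightarrow> real"
  assumes "\<delta> > 0"
  obtains P where "decidable_in \<O> (3 * N) (\<lambda>fs n. P fs)"
    and "\<And>\<xi> f g h. \<lbrakk>\<forall>j<N. names (f j) (g j) (h j) (\<xi> j); \<forall>j<N. \<bar>\<xi> j - c j\<bar> < \<delta>\<rbrakk> \<Longrightarrow>
      P (concat (map (\<lambda>j. [f j, g j, h j]) [0..<N]))"
    and "\<And>\<xi> f g h. \<lbrakk>\<forall>j<N. names (f j) (g j) (h j) (\<xi> j);
      P (concat (map (\<lambda>j. [f j, g j, h j]) [0..<N]))\<rbrakk> \<Longrightarrow> \<forall>j<N. \<bar>\<xi> j - c j\<bar> < 4 * \<delta>"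
proof -
  obtain t :: nat where t: "1 / (real t + 1) < \<delta>"
    using nat_approx_posE[OF assms] by (metis of_nat_Suc add.commute)
  \<comment> \<open>The center may be irrational, whereas comparison is available only with rational
    bounds, so these are picked inside the gap.\<close>
  have "\<exists>l\<in>\<rat>. c j - 3 * \<delta> < l \<and> l < c j - 2 * \<delta>" for j
    using assms by (intro Rats_dense_in_real) simp
  then obtain l where l: "\<And>j. l j \<in> \<rat>" "\<And>j. c j - 3 * \<delta> < l j" "\<And>j. l j < c j - 2 * \<delta>"
    by metis
  have "\<exists>u\<in>\<rat>. c j + 2 * \<delta> < u \<and> u < c j + 3 * \<delta>" for j
    using assms by (intro Rats_dense_in_real) simp
  then obtain u where u: "\<And>j. u j \<in> \<rat>" "\<And>j. c j + 2 * \<delta> < u j" "\<And>j. u j < c j + 3 * \<delta>"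
    by metis
  define a where "a fs j =
    (real ((fs ! (3 * j)) t) - real ((fs ! (3 * j + 1)) t)) / (real ((fs ! (3 * j + 2)) t) + 1)"
    for fs :: "(nat \<Rightarrow> nat) list" and j
  define P where "P fs \<longleftrightarrow> (\<forall>j<N. \<not> a fs j \<le> l j \<and> a fs j \<le> u j)" for fs
  \<comment> \<open>Reading a name at the fixed precision \<open>t\<close> is composition with a
    constant function.\<close>
  have eval: "in_class \<O> (3 * N) (\<lambda>fs n. (fs ! i) t)" if "i < 3 * N" for i
    using in_class_comp[OF in_class_proj[OF that] in_class_const] .
  have le: "decidable_in \<O> (3 * N) (\<lambda>fs n. a fs j \<le> r)" if "j < N" "r \<in> \<rat>" for j r
    unfolding a_def using that by (intro decidable_in_fraction_le_Rats eval) auto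
  have approx: "\<bar>a (concat (map (\<lambda>j. [f j, g j, h j]) [0..<N])) j - \<xi> j\<bar> < \<delta>"
    if "\<forall>j<N. names (f j) (g j) (h j) (\<xi> j)" "j < N" for f g h \<xi> j
    using that t unfolding a_def nth_concat_triples[OF \<open>j < N\<close>] names_def
    by (meson less_trans)
  have "decidable_in \<O> (3 * N) (\<lambda>fs n. P fs)"
    unfolding P_def
    by (intro decidable_in_ball decidable_in_conj decidable_in_not le l u)
  moreover have "P (concat (map (\<lambda>j. [f j, g j, h j]) [0..<N]))"
    if "\<forall>j<N. names (f j) (g j) (h j) (\<xi> j)" "\<forall>j<N. \<bar>\<xi> j - c j\<bar> < \<delta>" for f g h \<xi>
    unfolding P_def
  proof (intro allI impI)
    fix j assume "j < N"
    with approx[OF that(1) this] that(2) l(3)[of j] u(2)[of j]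
    show "\<not> a (concat (map (\<lambda>j. [f j, g j, h j]) [0..<N])) j \<le> l j \<and>
        a (concat (map (\<lambda>j. [f j, g j, h j]) [0..<N])) j \<le> u j"
      by (smt (verit))
  qed
  moreover have "\<forall>j<N. \<bar>\<xi> j - c j\<bar> < 4 * \<delta>"
    if "\<forall>j<N. names (f j) (g j) (h j) (\<xi> j)" "P (concat (map (\<lambda>j. [f j, g j, h j]) [0..<N]))"
    for f g h \<xi>
  proof (intro allI impI)
    fix j assume "j < N"
    with approx[OF that(1) this] that(2) l(2)[of j] u(3)[of j]
    show "\<bar>\<xi> j - c j\<bar> < 4 * \<delta>"
      unfolding P_def by (smt (verit))
  qed
  ultimately show ?thesis
    using that by blast
qed

text \<open>A passed test puts the point in the fourfold box, where the first algorithm works; a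
  failed one excludes the small box, leaving only \<open>B\<close>. The inclusion
  \<open>B \<subseteq> D\<close> covers points of \<open>B\<close> that pass the test.\<close>

lemma uniformly_computable_Un_box:
  assumes "uniformly_computable \<O> N {\<xi>\<in>D. \<forall>j<N. \<bar>\<xi> j - c j\<bar> < 4 * \<delta>} \<theta>"
    and "uniformly_computable \<O> N B \<theta>" "B \<subseteq> D" "\<delta> > 0"
  shows "uniformly_computable \<O> N ({\<xi>\<in>D. \<forall>j<N. \<bar>\<xi> j - c j\<bar> < \<delta>} \<union> B) \<theta>"
proof (rule decidable_box_test[OF \<open>\<delta> > 0\<close>, of N c])
  fix P
  assume P: "decidable_in \<O> (3 * N) (\<lambda>fs n. P fs)"
    and inner: "\<And>\<xi> f g h. \<lbrakk>\<forall>j<N. names (f j) (g j) (h j) (\<xi> j); \<forall>j<N. \<bar>\<xi> j - c j\<bar> < \<delta>\<rbrakk> \<Longrightarrow>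
      P (concat (map (\<lambda>j. [f j, g j, h j]) [0..<N]))"
    and outer: "\<And>\<xi> f g h. \<lbrakk>\<forall>j<N. names (f j) (g j) (h j) (\<xi> j);
      P (concat (map (\<lambda>j. [f j, g j, h j]) [0..<N]))\<rbrakk> \<Longrightarrow> \<forall>j<N. \<bar>\<xi> j - c j\<bar> < 4 * \<delta>"
  show ?thesis
  proof (rule uniformly_computable_case_distinction[OF P assms(1,2)])
    fix \<xi> f g h
    assume \<xi>: "\<xi> \<in> {\<xi>\<in>D. \<forall>j<N. \<bar>\<xi> j - c j\<bar> < \<delta>} \<union> B"
      and names: "\<forall>j<N. names (f j) (g j) (h j) (\<xi> j)"
    show "if P (concat (map (\<lambda>j. [f j, g j, h j]) [0..<N]))
      then \<xi> \<in> {\<xi>\<in>D. \<forall>j<N. \<bar>\<xi> j - c j\<bar> < 4 * \<delta>} else \<xi> \<in> B"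
      using \<xi> inner[OF names] outer[OF names] \<open>B \<subseteq> D\<close> by auto
  qed
qed

text \<open>The boxes are tested one after another: each new box is put in front, and the algorithm
  for the remaining union is the fallback.\<close>

lemma uniformly_computable_finite_boxes:
  assumes "finite C"
    and "\<And>c. c \<in> C \<Longrightarrow> \<delta> c > 0"
    and "\<And>c. c \<in> C \<Longrightarrow> uniformly_computable \<O> N {\<xi>\<in>D. \<forall>j<N. \<bar>\<xi> j - c j\<bar> < 4 * \<delta> c} \<theta>"
  shows "uniformly_computable \<O> N (\<Union>c\<in>C. {\<xi>\<in>D. \<forall>j<N. \<bar>\<xi> j - c j\<bar> < \<delta> c}) \<theta>"
  using assms
proof (induction C rule: finite_induct)
  case empty
  then show ?case
    by (simp add: uniformly_computable_empty)
next
  case (insert c C)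
  then have "uniformly_computable \<O> N (\<Union>c\<in>C. {\<xi>\<in>D. \<forall>j<N. \<bar>\<xi> j - c j\<bar> < \<delta> c}) \<theta>"
    by simp
  from uniformly_computable_Un_box[OF insert.prems(2)[of c] this] show ?case
    using insert.prems(1)[of c] by auto
qed

end

section \<open>Boxes in Euclidean space\<close>

lemma openin_Euclidean_space_box:
  "openin (Euclidean_space N) {\<xi> \<in> topspace (Euclidean_space N). \<forall>j<N. \<bar>\<xi> j - c j\<bar> < \<delta>}"
proof -
  have "openin (Euclidean_space N)
      {\<xi> \<in> topspace (Euclidean_space N). \<xi> j \<in> {c j - \<delta> <..< c j + \<delta>}}" for j
  proof (rule openin_continuous_map_preimage)
    show "continuous_map (Euclidean_space N) euclideanreal (\<lambda>\<xi>. \<xi> j)"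
      unfolding Euclidean_space_def
      by (intro continuous_map_from_subtopology continuous_map_product_coordinates) simp
  qed simp
  \<comment> \<open>Intersecting with the whole space covers \<open>N = 0\<close>, where the family
    is empty and its intersection would be \<open>UNIV\<close>.\<close>
  then have "openin (Euclidean_space N) (topspace (Euclidean_space N) \<inter>
      \<Inter> ((\<lambda>j. {\<xi> \<in> topspace (Euclidean_space N). \<xi> j \<in> {c j - \<delta> <..< c j + \<delta>}}) ` {..<N}))"
    by (intro openin_Int_Inter) auto
  also have "topspace (Euclidean_space N) \<inter>
      \<Inter> ((\<lambda>j. {\<xi> \<in> topspace (Euclidean_space N). \<xi> j \<in> {c j - \<delta> <..< c j + \<delta>}}) ` {..<N}) =
      {\<xi> \<in> topspace (Euclidean_space N). \<forall>j<N. \<bar>\<xi> j - c j\<bar> < \<delta>}"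
    by (auto simp: abs_less_iff algebra_simps)
  finally show ?thesis .
qed

text \<open>The space is a subspace of an infinite product, so a basic product neighbourhood
  constrains coordinates beyond \<open>N\<close> too. Those vanish both at the center and at every
  point of the space, which leaves only the first \<open>N\<close> radii to be minimized.\<close>

lemma openin_Euclidean_space_contains_box:
  assumes "openin (Euclidean_space N) V" "c \<in> V"
  obtains \<epsilon> where "\<epsilon> > 0"
    "{\<xi> \<in> topspace (Euclidean_space N). \<forall>j<N. \<bar>\<xi> j - c j\<bar> < \<epsilon>} \<subseteq> V"
proof -
  obtain W where W: "openin (powertop_real UNIV) W" "V = W \<inter> topspace (Euclidean_space N)"
    using assms(1) unfolding topspace_Euclidean_space
    by (auto simp: Euclidean_space_def openin_subtopology)
  with assms(2) have "c \<in> W" and c: "\<And>j. j \<ge> N \<Longrightarrow> c j = 0"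
    by (auto simp: topspace_Euclidean_space)
  with W(1) obtain U where U: "\<And>j. open (U j)" "c \<in> Pi\<^sub>E UNIV U" "Pi\<^sub>E UNIV U \<subseteq> W"
    unfolding openin_product_topology_alt by force
  have "\<exists>e>0. ball (c j) e \<subseteq> U j" for j
    using U(1,2) by (meson PiE_mem UNIV_I open_contains_ball)
  then obtain e where e: "\<And>j. e j > 0" "\<And>j. ball (c j) (e j) \<subseteq> U j"
    by metis
  \<comment> \<open>The inserted 1 keeps the set nonempty when \<open>N = 0\<close>.\<close>
  define \<epsilon> where "\<epsilon> = Min (insert 1 (e ` {..<N}))"
  have "\<epsilon> > 0"
    using e(1) by (auto simp: \<epsilon>_def)
  moreover have "\<xi> \<in> V"
    if \<xi>: "\<xi> \<in> topspace (Euclidean_space N)" "\<forall>j<N. \<bar>\<xi> j - c j\<bar> < \<epsilon>" for \<xi>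
  proof -
    have "\<xi> j \<in> U j" for j
    proof (cases "j < N")
      case True
      then have "\<epsilon> \<le> e j"
        by (auto simp: \<epsilon>_def)
      with True \<xi>(2) have "\<xi> j \<in> ball (c j) (e j)"
        by (force simp: dist_real_def)
      with e(2) show ?thesis
        by blast
    next
      case False
      with \<xi>(1) c[of j] have "\<xi> j = c j"
        by (simp add: topspace_Euclidean_space)
      with U(2) show ?thesis
        by auto
    qed
    with U(3) W(2) \<xi>(1) show ?thesis
      by blast
  qed
  ultimately show ?thesis
    using that by blast
qed

section \<open>Passage to a finite subcover of the compact domain\<close>

theorem theorem3:
  fixes \<O> :: "nat \<Rightarrow> operator set"
    and N :: nat
    and D :: "(nat \<Rightarrow> real) set"
    and \<theta> :: "(nat \<Rightarrow> real) \<Rightarrow> real"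
  assumes "decent \<O>"
    and "D \<subseteq> topspace (Euclidean_space N)"
    and "compactin (Euclidean_space N) D"
    and "locally_uniformly_computable \<O> N D \<theta>"
  shows "uniformly_computable \<O> N D \<theta>"
proof -
  have "\<exists>\<delta>>0. uniformly_computable \<O> N {\<xi>\<in>D. \<forall>j<N. \<bar>\<xi> j - c j\<bar> < 4 * \<delta>} \<theta>" if "c \<in> D" for c
  proof -
    from assms(4) \<open>c \<in> D\<close> obtain U V where V: "openin (Euclidean_space N) V" "c \<in> V" "V \<subseteq> U"
      and U: "uniformly_computable \<O> N (D \<inter> U) \<theta>"
      unfolding locally_uniformly_computable_def by blast
    obtain \<epsilon> where "\<epsilon> > 0"
      and box: "{\<xi> \<in> topspace (Euclidean_space N). \<forall>j<N. \<bar>\<xi> j - c j\<bar> < \<epsilon>} \<subseteq> V"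
      using openin_Euclidean_space_contains_box[OF V(1,2)] .
    \<comment> \<open>A quarter of the radius is taken so that the fourfold box, where the
      approximate test is sound, still lies in the neighbourhood.\<close>
    have "{\<xi>\<in>D. \<forall>j<N. \<bar>\<xi> j - c j\<bar> < 4 * (\<epsilon> / 4)} \<subseteq> D \<inter> U"
      using box V(3) assms(2) by auto
    with U have "uniformly_computable \<O> N {\<xi>\<in>D. \<forall>j<N. \<bar>\<xi> j - c j\<bar> < 4 * (\<epsilon> / 4)} \<theta>"
      by (rule uniformly_computable_subset[OF assms(1)])
    with \<open>\<epsilon> > 0\<close> show ?thesis
      by (intro exI[of _ "\<epsilon> / 4"]) simp
  qed
  then have "\<exists>\<delta>. \<forall>c\<in>D. \<delta> c > 0 \<and>
      uniformly_computable \<O> N {\<xi>\<in>D. \<forall>j<N. \<bar>\<xi> j - c j\<bar> < 4 * \<delta> c} \<theta>"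
    by (intro bchoice) blast
  then obtain \<delta> where \<delta>: "\<And>c. c \<in> D \<Longrightarrow> \<delta> c > 0"
    "\<And>c. c \<in> D \<Longrightarrow> uniformly_computable \<O> N {\<xi>\<in>D. \<forall>j<N. \<bar>\<xi> j - c j\<bar> < 4 * \<delta> c} \<theta>"
    by blast
  \<comment> \<open>Compactness calls for open subsets of the whole space, so the cover uses full
    boxes; the algorithms are glued on their traces on \<open>D\<close>.\<close>
  define box where
    "box c = {\<xi> \<in> topspace (Euclidean_space N). \<forall>j<N. \<bar>\<xi> j - c j\<bar> < \<delta> c}" for c
  have "\<forall>U\<in>box ` D. openin (Euclidean_space N) U"
    unfolding box_def using openin_Euclidean_space_box by blast
  moreover have "D \<subseteq> \<Union> (box ` D)"
    using assms(2) \<delta>(1) by (force simp: box_def)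
  ultimately obtain \<F> where "finite \<F>" "\<F> \<subseteq> box ` D" "D \<subseteq> \<Union> \<F>"
    using assms(3) unfolding compactin_def by metis
  then obtain C where C: "finite C" "C \<subseteq> D" "D \<subseteq> (\<Union>c\<in>C. box c)"
    by (metis finite_subset_image)
  have "uniformly_computable \<O> N (\<Union>c\<in>C. {\<xi>\<in>D. \<forall>j<N. \<bar>\<xi> j - c j\<bar> < \<delta> c}) \<theta>"
    using C(2) by (intro uniformly_computable_finite_boxes assms(1) C(1) \<delta>) auto
  moreover have "D \<subseteq> (\<Union>c\<in>C. {\<xi>\<in>D. \<forall>j<N. \<bar>\<xi> j - c j\<bar> < \<delta> c})"
    using C(3) by (auto simp: box_def)
  ultimately show ?thesis
    by (rule uniformly_computable_subset[OF assms(1)])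
qed

end
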